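(* Let $(X,d_X)$ be a Polish space and let $d_{\mathcal P}:\mathcal P_c(X)\times\mathcal P_c(X)\to[0,+\infty)$ be a bounded distance function. Let $f:\mathbb R_{>0}\to\mathbb R_{>0}$ be a Lipschitz, increasing function such that $$\sup_{\substack{m_1,m_2\in\mathbb R_{>0}\\ m_1\neq m_2}}\frac{|f(m_1)-f(m_2)|}{|m_1-m_2|}\le\frac{1}{\operatorname{diam}\mathcal P_c(X)}\quad\text{and}\quad\lim_{m\searrow0}f(m)=0.$$ Then the function $d_{\mathcal M_0}:\mathcal M_c(X)\times\mathcal M_c(X)\to[0,+\infty)$ defined by setting $$d_{\mathcal M_0}(m_1\mu_1,m_2\mu_2):=|m_1-m_2|+\min\{f(m_1),f(m_2)\}\,d_{\mathcal P}(\mu_1,\mu_2)$$ for every $m_1,m_2\in\mathbb R_{>0}$ and $\mu_1,\mu_2\in\mathcal P_c(X)$, and $$d_{\mathcal M_0}(0,m\mu)=d_{\mathcal M_0}(m\mu,0):=m,\qquad d_{\mathcal M_0}(0,0):=0$$ for every $m\in\mathbb R_{>0}$ and $\mu\in\mathcal P_c(X)$, is a distance function on $\mathcal M_c(X)$.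
   Context: $\mathbb R_{>0}=(0,+\infty)$. $\mathcal M_c(X)$ is the set of non-negative Borel measures on $X$ with finite total mass and compact support (including the zero measure, denoted $0$), and $\mathcal P_c(X)$ is the set of Borel probability measures on $X$ with compact support. Every nonzero element of $\mathcal M_c(X)$ is written uniquely as $m\mu$ with $m\in\mathbb R_{>0}$ its total mass and $\mu\in\mathcal P_c(X)$. A distance function on a set is a metric in the usual sense (with finite values); $d_{\mathcal P}$ is an arbitrary bounded metric on the set $\mathcal P_c(X)$. $\operatorname{diam}\mathcal P_c(X)=\sup_{\mu,\nu\in\mathcal P_c(X)}d_{\mathcal P}(\mu,\nu)$ is the diameter with respect to $d_{\mathcal P}$ (with the convention $1/0=+\infty$). *)

theory Defs
  imports "HOL-Probability.Probability"
begin

definition measure_support :: "'a::topological_space measure \<Rightarrow> 'a set" where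
  "measure_support M = {x. \<forall>U. open U \<longrightarrow> x \<in> U \<longrightarrow> emeasure M U > 0}"

definition Mc :: "'a::topological_space measure set" where
  "Mc = {M. sets M = sets borel \<and> finite_measure M \<and> compact (measure_support M)}"

definition Pc :: "'a::topological_space measure set" where
  "Pc = {M. sets M = sets borel \<and> prob_space M \<and> compact (measure_support M)}"

definition zero_measure :: "'a::topological_space measure" where
  "zero_measure = null_measure borel"

definition mass :: "'a measure \<Rightarrow> real" where
  "mass M = measure M (space M)"

definition normalized :: "'a measure \<Rightarrow> 'a measure" where
  "normalized M = scale_measure (ennreal (1 / mass M)) M"

text \<open>Extended-real valued, so that \<open>1 / diam_Pc d = \<infinity>\<close> when the diameter is zero.\<close>

definition diam_Pc :: "('a::topological_space measure \<Rightarrow> 'a measure \<Rightarrow> real) \<Rightarrow> ereal" where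
  "diam_Pc d = (SUP (\<mu>, \<nu>) \<in> Pc \<times> Pc. ereal (d \<mu> \<nu>))"

text \<open>A nonzero \<open>M \<in> Mc\<close> is \<open>m \<mu>\<close> with \<open>m = mass M\<close> and \<open>\<mu> = normalized M\<close>; the lemmas
  below give the defining equations in terms of \<open>m\<close> and \<open>\<mu>\<close>. The value \<open>0\<close> outside
  \<open>Mc\<close> is a dummy: the locale \<open>Metric_space\<close> asks for nonnegativity and symmetry
  on the whole type.\<close>

definition d_M0 ::
  "('a::topological_space measure \<Rightarrow> 'a measure \<Rightarrow> real) \<Rightarrow> (real \<Rightarrow> real)
    \<Rightarrow> 'a measure \<Rightarrow> 'a measure \<Rightarrow> real" where
  "d_M0 d f M N =
    (if M \<notin> Mc \<or> N \<notin> Mc then 0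
     else if M = zero_measure \<and> N = zero_measure then 0
     else if M = zero_measure then mass N
     else if N = zero_measure then mass M
     else \<bar>mass M - mass N\<bar>
          + min (f (mass M)) (f (mass N)) * d (normalized M) (normalized N))"

lemma measure_support_scale:
  assumes "m > 0"
  shows "measure_support (scale_measure (ennreal m) M) = measure_support M"
  using assms by (simp add: measure_support_def ennreal_zero_less_mult_iff)

lemma zero_measure_in_Mc: "zero_measure \<in> Mc"
proof -
  have "measure_support (zero_measure :: 'a measure) = {}"
    by (auto simp: measure_support_def zero_measure_def)
  moreover have "finite_measure (zero_measure :: 'a measure)"
    by (rule finite_measureI) (simp add: zero_measure_def)
  ultimately show ?thesis
    by (simp add: Mc_def zero_measure_def)
qed

lemma mass_scale:
  assumes "\<mu> \<in> Pc" "m > 0"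
  shows "mass (scale_measure (ennreal m) \<mu>) = m"
proof -
  interpret prob_space \<mu> using assms(1) by (simp add: Pc_def)
  show ?thesis
    using assms(2) by (simp add: mass_def measure_def emeasure_space_1 space_scale_measure)
qed

lemma scale_in_Mc:
  assumes "\<mu> \<in> Pc" "m > 0"
  shows "scale_measure (ennreal m) \<mu> \<in> Mc"
proof -
  interpret prob_space \<mu> using assms(1) by (simp add: Pc_def)
  have "finite_measure (scale_measure (ennreal m) \<mu>)"
    by (rule finite_measureI) (simp add: space_scale_measure emeasure_space_1)
  then show ?thesis
    using assms by (simp add: Mc_def Pc_def measure_support_scale)
qed

lemma scale_neq_zero:
  assumes "\<mu> \<in> Pc" "m > 0"
  shows "scale_measure (ennreal m) \<mu> \<noteq> zero_measure"
proof
  assume "scale_measure (ennreal m) \<mu> = zero_measure"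
  then have "mass (scale_measure (ennreal m) \<mu>) = 0"
    by (simp add: mass_def zero_measure_def measure_def)
  with mass_scale[OF assms] assms(2) show False by simp
qed

lemma normalized_scale:
  assumes "\<mu> \<in> Pc" "m > 0"
  shows "normalized (scale_measure (ennreal m) \<mu>) = \<mu>"
  using assms by (simp add: normalized_def mass_scale flip: ennreal_mult)

lemma Mc_polar:
  assumes "M \<in> Mc" "M \<noteq> zero_measure"
  shows "mass M > 0" "normalized M \<in> Pc" "M = scale_measure (ennreal (mass M)) (normalized M)"
proof -
  interpret finite_measure M using assms(1) by (simp add: Mc_def)
  have sM: "sets M = sets borel" using assms(1) by (simp add: Mc_def)
  show pos: "mass M > 0"
  proof (rule ccontr)
    assume "\<not> mass M > 0"
    then have "emeasure M (space M) = 0"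
      by (simp add: mass_def emeasure_eq_measure zero_less_measure_iff)
    then have "emeasure M A = emeasure zero_measure A" if "A \<in> sets M" for A
      using that emeasure_space[of M A] by (simp add: zero_measure_def)
    then have "M = zero_measure"
      by (intro measure_eqI) (simp_all add: sM zero_measure_def)
    with assms(2) show False by simp
  qed
  have "emeasure (normalized M) (space (normalized M)) = 1"
    using pos
    by (simp add: normalized_def space_scale_measure emeasure_eq_measure mass_def flip: ennreal_mult)
  then have "prob_space (normalized M)" by (rule prob_spaceI)
  then show "normalized M \<in> Pc"
    using assms(1) pos measure_support_scale[of "1 / mass M" M]
    by (simp add: Pc_def Mc_def normalized_def)
  show "M = scale_measure (ennreal (mass M)) (normalized M)"
    using pos by (simp add: normalized_def flip: ennreal_mult)
qed

lemma d_M0_scale_scale: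
  assumes "\<mu>1 \<in> Pc" "\<mu>2 \<in> Pc" "m1 > 0" "m2 > 0"
  shows "d_M0 d f (scale_measure (ennreal m1) \<mu>1) (scale_measure (ennreal m2) \<mu>2)
    = \<bar>m1 - m2\<bar> + min (f m1) (f m2) * d \<mu>1 \<mu>2"
  using assms by (simp add: d_M0_def scale_in_Mc scale_neq_zero mass_scale normalized_scale)

lemma d_M0_zero:
  assumes "\<mu> \<in> Pc" "m > 0"
  shows "d_M0 d f zero_measure (scale_measure (ennreal m) \<mu>) = m"
    and "d_M0 d f (scale_measure (ennreal m) \<mu>) zero_measure = m"
    and "d_M0 d f zero_measure zero_measure = 0"
  using assms by (simp_all add: d_M0_def zero_measure_in_Mc scale_in_Mc scale_neq_zero mass_scale)

end

theory Submission
  imports Defs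
begin

text \<open>In the triangle inequality between measures of masses \<open>a\<close> and \<open>c\<close>
  through one of mass \<open>b\<close>, only \<open>b < min a c\<close>
  is delicate: passing through the smaller mass costs an extra \<open>2 * (min a c - b)\<close>, which pays for
  the drop of the weight from \<open>f (min a c)\<close> to \<open>f b\<close>, because the Lipschitz constant of
  \<open>f\<close> times the diameter is at most \<open>1\<close>. The vertex \<open>0\<close> is the limit \<open>b \<rightarrow> 0\<close>,
  which gives \<open>f m * d \<mu> \<nu> \<le> m\<close>.\<close>

text \<open>A single distance is at most the diameter, so every slope of \<open>f\<close> is at most
  the reciprocal of \<open>d \<mu> \<nu>\<close>. The product form also covers
  \<open>d \<mu> \<nu> = 0\<close>.\<close>

lemma mult_le_of_SUP_slope_le_inverse_diam_Pc:
  assumes slope: "(SUP (m1, m2) \<in> {(m1, m2). m1 > 0 \<and> m2 > 0 \<and> m1 \<noteq> m2}.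
            ereal (\<bar>f m1 - f m2\<bar> / \<bar>m1 - m2\<bar>)) \<le> 1 / diam_Pc d"
    and "\<mu> \<in> Pc" "\<nu> \<in> Pc" "0 \<le> d \<mu> \<nu>" "0 < a" "0 < b"
  shows "\<bar>f a - f b\<bar> * d \<mu> \<nu> \<le> \<bar>a - b\<bar>"
proof (cases "a = b \<or> d \<mu> \<nu> = 0")
  case False
  then have ab: "a \<noteq> b" and d: "0 < d \<mu> \<nu>" using assms by auto
  have "ereal (d \<mu> \<nu>) \<le> diam_Pc d"
    unfolding diam_Pc_def using assms by (intro SUP_upper2[of "(\<mu>, \<nu>)"]) auto
  then have "1 / diam_Pc d \<le> 1 / ereal (d \<mu> \<nu>)"
    using d by (cases "diam_Pc d") (auto simp: field_simps)
  moreover have "ereal (\<bar>f a - f b\<bar> / \<bar>a - b\<bar>) \<le> 1 / diam_Pc d"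
    using assms ab by (intro order_trans[OF _ slope] SUP_upper2[of "(a, b)"]) auto
  ultimately have "ereal (\<bar>f a - f b\<bar> / \<bar>a - b\<bar>) \<le> 1 / ereal (d \<mu> \<nu>)"
    by (rule order_trans[rotated])
  then have "\<bar>f a - f b\<bar> / \<bar>a - b\<bar> \<le> 1 / d \<mu> \<nu>"
    using d by (simp add: one_ereal_def)
  moreover have "0 < \<bar>a - b\<bar>" using ab by simp
  ultimately show ?thesis using d by (simp add: divide_simps mult.commute split: if_splits)
qed auto

text \<open>Letting \<open>b\<close> tend to 0 in \<open>lip\<close> makes \<open>f b\<close>
  vanish. The bound serves the triangle inequality through the zero measure.\<close>

lemma mult_le_of_tendsto_0:
  fixes f :: "real \<Rightarrow> real"
  assumes lim: "(f \<longlongrightarrow> 0) (at_right 0)" and "0 < m" "0 \<le> D"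
    and lip: "\<And>b. 0 < b \<Longrightarrow> \<bar>f m - f b\<bar> * D \<le> \<bar>m - b\<bar>"
  shows "f m * D \<le> m"
proof -
  have "((\<lambda>b. (f m - f b) * D) \<longlongrightarrow> (f m - 0) * D) (at_right 0)"
    by (intro tendsto_intros lim)
  moreover have "((\<lambda>b. \<bar>m - b\<bar>) \<longlongrightarrow> \<bar>m - 0\<bar>) (at_right 0)"
    by (intro tendsto_intros)
  moreover have "\<forall>\<^sub>F b in at_right 0. (f m - f b) * D \<le> \<bar>m - b\<bar>"
    using order_trans[OF mult_right_mono[OF abs_ge_self \<open>0 \<le> D\<close>] lip]
    by (auto simp: eventually_at_filter)
  ultimately have "(f m - 0) * D \<le> \<bar>m - 0\<bar>"
    by (intro tendsto_le[OF trivial_limit_at_right_real])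
  then show ?thesis using \<open>0 < m\<close> by simp
qed

text \<open>Under the least of the three weights, \<open>tri\<close> applies directly. Monotonicity
  then raises the weights on the right, and the path of the masses pays for the gap on the
  left.\<close>

lemma weighted_triangle:
  fixes f :: "real \<Rightarrow> real"
  assumes mono: "mono_on {0<..} f" and pos: "\<And>m. 0 < m \<Longrightarrow> 0 < f m"
    and "0 < a" "0 < b" "0 < c"
    and "0 \<le> D12" "0 \<le> D23" and tri: "D13 \<le> D12 + D23"
    and lip: "\<And>m. 0 < m \<Longrightarrow> \<bar>f m - f b\<bar> * D13 \<le> \<bar>m - b\<bar>"
  shows "\<bar>a - c\<bar> + min (f a) (f c) * D13
    \<le> (\<bar>a - b\<bar> + min (f a) (f b) * D12) + (\<bar>b - c\<bar> + min (f b) (f c) * D23)"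
proof -
  have f_min: "min (f x) (f y) = f (min x y)" if "0 < x" "0 < y" for x y
    using that mono_onD[OF mono, of x y] mono_onD[OF mono, of y x]
    by (cases "x \<le> y") (auto simp: min_def)
  have f_mono: "f x \<le> f y" if "0 < x" "x \<le> y" for x y
    using that by (auto intro: mono_onD[OF mono])
  define w where "w = f (min (min a c) b)"
  have "0 < w" using assms by (simp add: w_def)
  have "w * D13 \<le> w * D12 + w * D23"
    using mult_left_mono[OF tri, of w] \<open>0 < w\<close> by (simp add: distrib_left)
  moreover have "w * D12 \<le> min (f a) (f b) * D12" "w * D23 \<le> min (f b) (f c) * D23"
    using assms by (auto simp: w_def f_min intro!: mult_right_mono f_mono)
  moreover have "\<bar>a - c\<bar> + f (min a c) * D13 \<le> \<bar>a - b\<bar> + \<bar>b - c\<bar> + w * D13"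
  proof (cases "b < min a c")
    \<comment> \<open>Here the masses travel \<open>\<bar>a - c\<bar> + 2 * (min a c - b)\<close>;
      one of the two copies of \<open>min a c - b\<close> already suffices.\<close>
    case True
    then have "0 \<le> f (min a c) - f b" using f_mono[of b "min a c"] \<open>0 < b\<close> by simp
    then have "f (min a c) * D13 \<le> f b * D13 + (min a c - b)"
      using lip[of "min a c"] True assms by (simp add: left_diff_distrib)
    then show ?thesis using True by (auto simp: w_def min_def split: if_splits)
  next
    case False
    then have "w = f (min a c)" by (simp add: w_def min_def)
    then show ?thesis by simp
  qed
  ultimately show ?thesis using assms by (simp add: f_min)
qed

theorem proposition1p3:
  fixes d_P :: "'a::polish_space measure \<Rightarrow> 'a measure \<Rightarrow> real"
    and f :: "real \<Rightarrow> real"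
  assumes "Metric_space Pc d_P"
    and "\<exists>B. \<forall>\<mu>\<in>Pc. \<forall>\<nu>\<in>Pc. d_P \<mu> \<nu> \<le> B"
    and "\<forall>m>0. f m > 0"
    and "\<exists>L. L-lipschitz_on {0<..} f"
    and "mono_on {0<..} f"
    and "(SUP (m1, m2) \<in> {(m1, m2). m1 > 0 \<and> m2 > 0 \<and> m1 \<noteq> m2}.
            ereal (\<bar>f m1 - f m2\<bar> / \<bar>m1 - m2\<bar>)) \<le> 1 / diam_Pc d_P"
    and "(f \<longlongrightarrow> 0) (at_right 0)"
  shows "Metric_space Mc (d_M0 d_P f)"
proof -
  interpret P: Metric_space Pc d_P by fact
  have pos: "\<And>m. 0 < m \<Longrightarrow> 0 < f m" using assms(3) by blast
  note polar = Mc_polar(1,2)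
  have lip: "\<bar>f a - f b\<bar> * d_P \<mu> \<nu> \<le> \<bar>a - b\<bar>"
    if "\<mu> \<in> Pc" "\<nu> \<in> Pc" "0 < a" "0 < b" for \<mu> \<nu> a b
    using mult_le_of_SUP_slope_le_inverse_diam_Pc[OF assms(6)] that by simp
  have bound: "f m * d_P \<mu> \<nu> \<le> m" if "\<mu> \<in> Pc" "\<nu> \<in> Pc" "0 < m" for \<mu> \<nu> m
    using that by (intro mult_le_of_tendsto_0[OF assms(7)] lip) auto
  \<comment> \<open>The measures \<mu> and \<nu> are arbitrary because \<open>Metric_space\<close>
    makes \<open>d_P\<close> nonnegative on the whole type.\<close>
  have weight_nonneg: "0 \<le> min (f (mass M)) (f (mass N)) * d_P \<mu> \<nu>"
    if "M \<in> Mc - {zero_measure}" "N \<in> Mc - {zero_measure}" for M N \<mu> \<nu>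
    using that polar[of M] polar[of N] pos by (auto simp: less_imp_le intro!: mult_nonneg_nonneg)
  show ?thesis
  proof
    fix M N :: "'a measure"
    show "0 \<le> d_M0 d_P f M N"
      using weight_nonneg[of M N] polar(1)[of M] polar(1)[of N]
      by (auto simp: d_M0_def less_imp_le)
    show "d_M0 d_P f M N = d_M0 d_P f N M"
      by (auto simp: d_M0_def P.commute min.commute abs_minus_commute)
  next
    fix M N :: "'a measure"
    assume MN: "M \<in> Mc" "N \<in> Mc"
    show "d_M0 d_P f M N = 0 \<longleftrightarrow> M = N"
    proof (cases "M = zero_measure \<or> N = zero_measure")
      case True
      then show ?thesis
        using MN polar(1)[of M] polar(1)[of N] by (auto simp: d_M0_def)
    next
      case False
      then have pM: "0 < mass M" "normalized M \<in> Pc" and pN: "0 < mass N" "normalized N \<in> Pc"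
        using MN polar by auto
      show ?thesis
      proof
        assume "d_M0 d_P f M N = 0"
        then have "\<bar>mass M - mass N\<bar>
            + min (f (mass M)) (f (mass N)) * d_P (normalized M) (normalized N) = 0"
          using False MN by (simp add: d_M0_def)
        moreover have "0 \<le> min (f (mass M)) (f (mass N)) * d_P (normalized M) (normalized N)"
          using False MN by (intro weight_nonneg) auto
        ultimately have "mass M = mass N"
          "min (f (mass M)) (f (mass N)) * d_P (normalized M) (normalized N) = 0"
          by linarith+
        \<comment> \<open>The weight at the common mass is strictly positive, so the distance factor
          must vanish.\<close>
        then have "mass M = mass N" "normalized M = normalized N"
          using pM pN pos[OF pM(1)] by auto
        then show "M = N"
          using Mc_polar(3)[of M] Mc_polar(3)[of N] MN False by metis
      qed (use False MN pM in \<open>simp add: d_M0_def\<close>)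
    qed
  next
    fix M N K :: "'a measure"
    assume Mc: "M \<in> Mc" "N \<in> Mc" "K \<in> Mc"
    show "d_M0 d_P f M K \<le> d_M0 d_P f M N + d_M0 d_P f N K"
    proof (cases "M = zero_measure \<or> K = zero_measure")
      \<comment> \<open>With an endpoint at zero, only the triangle inequality for masses remains,
        as the weighted terms on the right are nonnegative.\<close>
      case True
      then show ?thesis
        using Mc weight_nonneg[of M N "normalized M" "normalized N"]
          weight_nonneg[of N K "normalized N" "normalized K"]
          polar(1)[of M] polar(1)[of N] polar(1)[of K]
        by (auto simp: d_M0_def)
    next
      case MK: False
      then have p: "0 < mass M" "normalized M \<in> Pc" "0 < mass K" "normalized K \<in> Pc"
        using Mc polar by auto
      show ?thesis
      proof (cases "N = zero_measure")
        case True
        let ?d = "d_P (normalized M) (normalized K)"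
        \<comment> \<open>The path through zero has length \<open>mass M + mass K\<close>, which
          exceeds \<open>\<bar>mass M - mass K\<bar>\<close> by twice the smaller mass. It is enough
          that the weighted term is at most either mass.\<close>
        have "min (f (mass M)) (f (mass K)) * ?d \<le> mass M"
          "min (f (mass M)) (f (mass K)) * ?d \<le> mass K"
          using p by (auto intro: order_trans[OF mult_right_mono bound])
        then show ?thesis using True MK Mc p by (auto simp: d_M0_def)
      next
        case False
        then have "0 < mass N" "normalized N \<in> Pc" using Mc polar by auto
        then show ?thesis
          using False MK Mc p lip pos P.triangle assms(5)
            weighted_triangle[of f "mass M" "mass N" "mass K"
              "d_P (normalized M) (normalized N)" "d_P (normalized N) (normalized K)"
              "d_P (normalized M) (normalized K)"]
          by (simp add: d_M0_def)
      qed
    qed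
  qed
qed

end
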